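(* Let $R$ be a commutative ring (not necessarily Noetherian). The map $\xi:\mathcal Z_R\to\mathcal Y_R$, $\xi(I)=I:I$, is surjective, and the following conditions are equivalent. (1) The map $\rho:\mathcal X_R\to\mathcal Y_R$, $\rho(I)=I:I$, is surjective. (2) The map $\eta:\mathcal Y_R\to\mathcal X_R$, $\eta(A)=R:A$, is injective. (3) $A=R:(R:A)$ for every $A\in\mathcal Y_R$.
   Context: Let $W$ be the set of non-zerodivisors of $R$ and $\mathrm Q(R)=W^{-1}R$ the total ring of fractions. For $R$-submodules $X,Y$ of $\mathrm Q(R)$, $X:Y=\{a\in \mathrm Q(R)\mid aY\subseteq X\}$. An ideal $I$ of $R$ is regular if $I\cap W\neq\emptyset$; $\mathcal F_R$ is the set of regular ideals. For an $R$-module $M$, $\tau_R(M)$ is the ideal of $R$ generated by all $f(m)$ with $f\in\operatorname{Hom}_R(M,R)$, $m\in M$; an ideal of $R$ is a trace ideal in $R$ if it equals $\tau_R(M)$ for some $R$-module $M$. Define $\mathcal X_R=\{I\in\mathcal F_R\mid I \text{ is a trace ideal in } R\}$; $\mathcal Y_R=\{A\mid A \text{ is a subring of } \mathrm Q(R),\ R\subseteq A,\ aA\subseteq R\text{ for some } a\in W\}$; $\mathcal Z_R=\{I\in\mathcal F_R\mid I^2=aI\text{ for some } a\in I\}$. The maps $\xi$, $\eta$, $\rho$ given in the claim are well defined between these sets. *)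

theory Defs
  imports "HOL-Algebra.Module" "HOL-Algebra.Subrings" "HOL-Algebra.Ideal_Product"
begin

section \<open>Localization and the total ring of fractions\<close>

definition nonzerodivisors :: "('a, 'b) ring_scheme \<Rightarrow> 'a set" where
  "nonzerodivisors R =
     {w \<in> carrier R. \<forall>x \<in> carrier R. w \<otimes>\<^bsub>R\<^esub> x = \<zero>\<^bsub>R\<^esub> \<longrightarrow> x = \<zero>\<^bsub>R\<^esub>}"

definition frac_rel :: "('a, 'b) ring_scheme \<Rightarrow> 'a set \<Rightarrow> (('a \<times> 'a) \<times> ('a \<times> 'a)) set" where
  "frac_rel R S = {((r, s), (r', s')). r \<in> carrier R \<and> r' \<in> carrier R \<and> s \<in> S \<and> s' \<in> S \<and>
     (\<exists>t \<in> S. t \<otimes>\<^bsub>R\<^esub> (r \<otimes>\<^bsub>R\<^esub> s') = t \<otimes>\<^bsub>R\<^esub> (r' \<otimes>\<^bsub>R\<^esub> s))}"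

definition loc_frac :: "('a, 'b) ring_scheme \<Rightarrow> 'a set \<Rightarrow> 'a \<Rightarrow> 'a \<Rightarrow> ('a \<times> 'a) set" where
  "loc_frac R S r s = frac_rel R S `` {(r, s)}"

text \<open>For a multiplicative set \<open>S\<close>, each union below ranges over equal classes, so it is the
  usual operation on representatives; see \<open>frac_mult\<close> and \<open>frac_add\<close>.\<close>

definition localization :: "('a, 'b) ring_scheme \<Rightarrow> 'a set \<Rightarrow> ('a \<times> 'a) set ring" where
  "localization R S =
     \<lparr> carrier = (carrier R \<times> S) // frac_rel R S,
       mult = (\<lambda>F G. \<Union>p \<in> F. \<Union>q \<in> G.
                loc_frac R S (fst p \<otimes>\<^bsub>R\<^esub> fst q) (snd p \<otimes>\<^bsub>R\<^esub> snd q)),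
       one = loc_frac R S \<one>\<^bsub>R\<^esub> \<one>\<^bsub>R\<^esub>,
       zero = loc_frac R S \<zero>\<^bsub>R\<^esub> \<one>\<^bsub>R\<^esub>,
       add = (\<lambda>F G. \<Union>p \<in> F. \<Union>q \<in> G.
                loc_frac R S ((fst p \<otimes>\<^bsub>R\<^esub> snd q) \<oplus>\<^bsub>R\<^esub> (fst q \<otimes>\<^bsub>R\<^esub> snd p))
                  (snd p \<otimes>\<^bsub>R\<^esub> snd q)) \<rparr>"

definition total_frac :: "('a, 'b) ring_scheme \<Rightarrow> ('a \<times> 'a) set ring" where
  "total_frac R = localization R (nonzerodivisors R)"

definition to_frac :: "('a, 'b) ring_scheme \<Rightarrow> 'a \<Rightarrow> ('a \<times> 'a) set" where
  "to_frac R r = loc_frac R (nonzerodivisors R) r \<one>\<^bsub>R\<^esub>"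

lemma frac_rel_iff:
  "((r, s), (r', s')) \<in> frac_rel R S \<longleftrightarrow> r \<in> carrier R \<and> r' \<in> carrier R \<and> s \<in> S \<and> s' \<in> S \<and>
     (\<exists>t \<in> S. t \<otimes>\<^bsub>R\<^esub> (r \<otimes>\<^bsub>R\<^esub> s') = t \<otimes>\<^bsub>R\<^esub> (r' \<otimes>\<^bsub>R\<^esub> s))"
  by (simp add: frac_rel_def)

locale mult_set = cring R + submonoid S R for R (structure) and S
begin

lemma S_carrier: "s \<in> S \<Longrightarrow> s \<in> carrier R"
  using subset by blast

lemma equiv_frac_rel: "equiv (carrier R \<times> S) (frac_rel R S)"
proof (rule equivI)
  show "frac_rel R S \<subseteq> (carrier R \<times> S) \<times> (carrier R \<times> S)"
    by (auto simp: frac_rel_def)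
  show "refl_on (carrier R \<times> S) (frac_rel R S)"
    using one_closed by (auto simp: refl_on_def frac_rel_def)
  show "sym (frac_rel R S)"
    by (rule symI) (auto simp: frac_rel_def intro: sym)
  show "trans (frac_rel R S)"
  proof (rule transI, clarsimp simp: frac_rel_iff)
    fix a s b t c u v w
    assume h: "a \<in> carrier R" "s \<in> S" "b \<in> carrier R" "t \<in> S" "c \<in> carrier R" "u \<in> S"
      "v \<in> S" "w \<in> S" "v \<otimes> (a \<otimes> t) = v \<otimes> (b \<otimes> s)" "w \<otimes> (b \<otimes> u) = w \<otimes> (c \<otimes> t)"
    note c = h(1,3,5) S_carrier[OF h(2)] S_carrier[OF h(4)] S_carrier[OF h(6)]
      S_carrier[OF h(7)] S_carrier[OF h(8)]
    have "(v \<otimes> w \<otimes> t) \<otimes> (a \<otimes> u) = (w \<otimes> u) \<otimes> (v \<otimes> (a \<otimes> t))"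
      using c by (simp add: m_ac)
    also have "\<dots> = (v \<otimes> s) \<otimes> (w \<otimes> (b \<otimes> u))"
      using c unfolding h(9) by (simp add: m_ac)
    also have "\<dots> = (v \<otimes> w \<otimes> t) \<otimes> (c \<otimes> s)"
      using c unfolding h(10) by (simp add: m_ac)
    finally show "\<exists>t\<in>S. t \<otimes> (a \<otimes> u) = t \<otimes> (c \<otimes> s)"
      using h m_closed by blast
  qed
qed

lemma frac_eq_iff:
  assumes "r \<in> carrier R" "r' \<in> carrier R" "s \<in> S" "s' \<in> S"
  shows "loc_frac R S r s = loc_frac R S r' s' \<longleftrightarrow> (\<exists>t \<in> S. t \<otimes> (r \<otimes> s') = t \<otimes> (r' \<otimes> s))"
  using eq_equiv_class_iff[OF equiv_frac_rel, of "(r, s)" "(r', s')"] assms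
  by (simp add: loc_frac_def frac_rel_iff)

lemma frac_eqI:
  assumes "r \<in> carrier R" "r' \<in> carrier R" "s \<in> S" "s' \<in> S" "r \<otimes> s' = r' \<otimes> s"
  shows "loc_frac R S r s = loc_frac R S r' s'"
  using assms one_closed by (auto simp: frac_eq_iff)

lemma frac_in_carrier:
  "r \<in> carrier R \<Longrightarrow> s \<in> S \<Longrightarrow> loc_frac R S r s \<in> carrier (localization R S)"
  by (simp add: localization_def loc_frac_def quotientI)

lemma localization_carrierE:
  assumes "x \<in> carrier (localization R S)"
  obtains r s where "r \<in> carrier R" "s \<in> S" "s \<in> carrier R" "x = loc_frac R S r s"
  using assms by (auto simp: localization_def loc_frac_def S_carrier elim!: quotientE)

lemma frac_mult:
  assumes "r \<in> carrier R" "r' \<in> carrier R" "s \<in> S" "s' \<in> S"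
  shows "loc_frac R S r s \<otimes>\<^bsub>localization R S\<^esub> loc_frac R S r' s' = loc_frac R S (r \<otimes> r') (s \<otimes> s')"
proof -
  have "(\<lambda>p q. loc_frac R S (fst p \<otimes> fst q) (snd p \<otimes> snd q))
      respects2 frac_rel R S"
  proof (rule congruent2I', clarsimp simp: frac_rel_iff)
    fix a s a' s' b t b' t' v w
    assume h: "a \<in> carrier R" "s \<in> S" "a' \<in> carrier R" "s' \<in> S"
      "b \<in> carrier R" "t \<in> S" "b' \<in> carrier R" "t' \<in> S" "v \<in> S" "w \<in> S"
      "v \<otimes> (a \<otimes> s') = v \<otimes> (a' \<otimes> s)" "w \<otimes> (b \<otimes> t') = w \<otimes> (b' \<otimes> t)"
    note c = h(1,3,5,7) S_carrier[OF h(2)] S_carrier[OF h(4)] S_carrier[OF h(6)]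
      S_carrier[OF h(8)] S_carrier[OF h(9)] S_carrier[OF h(10)]
    have "(v \<otimes> w) \<otimes> (a \<otimes> b \<otimes> (s' \<otimes> t')) = (v \<otimes> (a \<otimes> s')) \<otimes> (w \<otimes> (b \<otimes> t'))"
      using c by (simp add: m_ac)
    also have "\<dots> = (v \<otimes> w) \<otimes> (a' \<otimes> b' \<otimes> (s \<otimes> t))"
      using c unfolding h(11,12) by (simp add: m_ac)
    finally show "loc_frac R S (a \<otimes> b) (s \<otimes> t) = loc_frac R S (a' \<otimes> b') (s' \<otimes> t')"
      using h(1-10) by (subst frac_eq_iff) (auto simp: S_carrier)
  qed
  from UN_equiv_class2[OF equiv_frac_rel equiv_frac_rel this, of "(r, s)" "(r', s')"] assms
  show ?thesis
    by (simp add: localization_def loc_frac_def case_prod_unfold)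
qed

lemma frac_add:
  assumes "r \<in> carrier R" "r' \<in> carrier R" "s \<in> S" "s' \<in> S"
  shows "loc_frac R S r s \<oplus>\<^bsub>localization R S\<^esub> loc_frac R S r' s' =
    loc_frac R S ((r \<otimes> s') \<oplus> (r' \<otimes> s)) (s \<otimes> s')"
proof -
  have "(\<lambda>p q. loc_frac R S ((fst p \<otimes> snd q) \<oplus> (fst q \<otimes> snd p)) (snd p \<otimes> snd q))
      respects2 frac_rel R S"
  proof (rule congruent2I', clarsimp simp: frac_rel_iff)
    fix a s a' s' b t b' t' v w
    assume h: "a \<in> carrier R" "s \<in> S" "a' \<in> carrier R" "s' \<in> S"
      "b \<in> carrier R" "t \<in> S" "b' \<in> carrier R" "t' \<in> S" "v \<in> S" "w \<in> S"
      "v \<otimes> (a \<otimes> s') = v \<otimes> (a' \<otimes> s)" "w \<otimes> (b \<otimes> t') = w \<otimes> (b' \<otimes> t)"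
    note c = h(1,3,5,7) S_carrier[OF h(2)] S_carrier[OF h(4)] S_carrier[OF h(6)]
      S_carrier[OF h(8)] S_carrier[OF h(9)] S_carrier[OF h(10)]
    have "(v \<otimes> w) \<otimes> (((a \<otimes> t) \<oplus> (b \<otimes> s)) \<otimes> (s' \<otimes> t')) =
        (v \<otimes> (a \<otimes> s')) \<otimes> (w \<otimes> (t \<otimes> t')) \<oplus> (w \<otimes> (b \<otimes> t')) \<otimes> (v \<otimes> (s \<otimes> s'))"
      using c by (simp add: m_ac l_distr r_distr)
    also have "\<dots> = (v \<otimes> w) \<otimes> (((a' \<otimes> t') \<oplus> (b' \<otimes> s')) \<otimes> (s \<otimes> t))"
      using c unfolding h(11,12) by (simp add: m_ac l_distr r_distr)
    finally show "loc_frac R S ((a \<otimes> t) \<oplus> (b \<otimes> s)) (s \<otimes> t) =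
        loc_frac R S ((a' \<otimes> t') \<oplus> (b' \<otimes> s')) (s' \<otimes> t')"
      using h(1-10) by (subst frac_eq_iff) (auto simp: S_carrier)
  qed
  from UN_equiv_class2[OF equiv_frac_rel equiv_frac_rel this, of "(r, s)" "(r', s')"] assms
  show ?thesis
    by (simp add: localization_def loc_frac_def case_prod_unfold)
qed

lemma localization_one: "\<one>\<^bsub>localization R S\<^esub> = loc_frac R S \<one> \<one>"
  and localization_zero: "\<zero>\<^bsub>localization R S\<^esub> = loc_frac R S \<zero> \<one>"
  by (simp_all add: localization_def)

lemma cring_localization: "cring (localization R S)" (is "cring ?L")
proof (rule cringI)
  note [simp] = frac_mult frac_add localization_one localization_zero frac_in_carrier
  note rep = localization_carrierE
  show "abelian_group ?L"
  proof (rule abelian_groupI)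
    fix x y assume x: "x \<in> carrier ?L" and y: "y \<in> carrier ?L"
    obtain r s where rs: "r \<in> carrier R" "s \<in> S" "s \<in> carrier R" "x = loc_frac R S r s"
      using x by (rule rep)
    obtain r' s' where rs': "r' \<in> carrier R" "s' \<in> S" "s' \<in> carrier R" "y = loc_frac R S r' s'"
      using y by (rule rep)
    show "x \<oplus>\<^bsub>?L\<^esub> y \<in> carrier ?L"
      using rs rs' by simp
    show "x \<oplus>\<^bsub>?L\<^esub> y = y \<oplus>\<^bsub>?L\<^esub> x"
      using rs rs' by (simp add: m_comm a_comm)
    show "\<zero>\<^bsub>?L\<^esub> \<oplus>\<^bsub>?L\<^esub> x = x"
      using rs by simp
    have "loc_frac R S (\<ominus> r) s \<oplus>\<^bsub>?L\<^esub> x = loc_frac R S \<zero> (s \<otimes> s)"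
      using rs by (simp add: l_minus l_neg)
    also have "\<dots> = \<zero>\<^bsub>?L\<^esub>"
      using rs by (simp, intro frac_eqI) simp_all
    finally show "\<exists>y \<in> carrier ?L. y \<oplus>\<^bsub>?L\<^esub> x = \<zero>\<^bsub>?L\<^esub>"
      using rs by (metis a_inv_closed frac_in_carrier)
    fix z assume z: "z \<in> carrier ?L"
    obtain q u where qu: "q \<in> carrier R" "u \<in> S" "u \<in> carrier R" "z = loc_frac R S q u"
      using z by (rule rep)
    show "x \<oplus>\<^bsub>?L\<^esub> y \<oplus>\<^bsub>?L\<^esub> z = x \<oplus>\<^bsub>?L\<^esub> (y \<oplus>\<^bsub>?L\<^esub> z)"
      using rs rs' qu by (simp add: m_ac a_ac l_distr r_distr)
  qed simp
  show "comm_monoid ?L"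
  proof (rule comm_monoidI)
    fix x y assume x: "x \<in> carrier ?L" and y: "y \<in> carrier ?L"
    obtain r s where rs: "r \<in> carrier R" "s \<in> S" "s \<in> carrier R" "x = loc_frac R S r s"
      using x by (rule rep)
    obtain r' s' where rs': "r' \<in> carrier R" "s' \<in> S" "s' \<in> carrier R" "y = loc_frac R S r' s'"
      using y by (rule rep)
    show "x \<otimes>\<^bsub>?L\<^esub> y \<in> carrier ?L"
      using rs rs' by simp
    show "x \<otimes>\<^bsub>?L\<^esub> y = y \<otimes>\<^bsub>?L\<^esub> x"
      using rs rs' by (simp add: m_comm)
    show "\<one>\<^bsub>?L\<^esub> \<otimes>\<^bsub>?L\<^esub> x = x"
      using rs by simp
    fix z assume z: "z \<in> carrier ?L"
    obtain q u where qu: "q \<in> carrier R" "u \<in> S" "u \<in> carrier R" "z = loc_frac R S q u"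
      using z by (rule rep)
    show "x \<otimes>\<^bsub>?L\<^esub> y \<otimes>\<^bsub>?L\<^esub> z = x \<otimes>\<^bsub>?L\<^esub> (y \<otimes>\<^bsub>?L\<^esub> z)"
      using rs rs' qu by (simp add: m_assoc)
  qed simp
  fix x y z assume x: "x \<in> carrier ?L" and y: "y \<in> carrier ?L" and z: "z \<in> carrier ?L"
  obtain r s where rs: "r \<in> carrier R" "s \<in> S" "s \<in> carrier R" "x = loc_frac R S r s"
    using x by (rule rep)
  obtain r' s' where rs': "r' \<in> carrier R" "s' \<in> S" "s' \<in> carrier R" "y = loc_frac R S r' s'"
    using y by (rule rep)
  obtain q u where qu: "q \<in> carrier R" "u \<in> S" "u \<in> carrier R" "z = loc_frac R S q u"
    using z by (rule rep)
  have "loc_frac R S ((r \<otimes> s' \<oplus> r' \<otimes> s) \<otimes> q) (s \<otimes> s' \<otimes> u) =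
    loc_frac R S ((r \<otimes> q) \<otimes> (s' \<otimes> u) \<oplus> (r' \<otimes> q) \<otimes> (s \<otimes> u)) ((s \<otimes> u) \<otimes> (s' \<otimes> u))"
  proof (rule frac_eqI)
    show "(r \<otimes> s' \<oplus> r' \<otimes> s) \<otimes> q \<otimes> ((s \<otimes> u) \<otimes> (s' \<otimes> u)) =
      ((r \<otimes> q) \<otimes> (s' \<otimes> u) \<oplus> (r' \<otimes> q) \<otimes> (s \<otimes> u)) \<otimes> (s \<otimes> s' \<otimes> u)"
      using rs(1,3) rs'(1,3) qu(1,3) by (simp add: m_ac l_distr r_distr)
  qed (use rs rs' qu in simp_all)
  then show "(x \<oplus>\<^bsub>?L\<^esub> y) \<otimes>\<^bsub>?L\<^esub> z = x \<otimes>\<^bsub>?L\<^esub> z \<oplus>\<^bsub>?L\<^esub> y \<otimes>\<^bsub>?L\<^esub> z"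
    using rs rs' qu by simp
qed

end

lemma (in cring) mult_set_nonzerodivisors: "mult_set R (nonzerodivisors R)"
proof (intro mult_set.intro cring_axioms submonoid.intro)
  show "x \<otimes> y \<in> nonzerodivisors R"
    if x: "x \<in> nonzerodivisors R" and y: "y \<in> nonzerodivisors R" for x y
  proof -
    have c: "x \<in> carrier R" "y \<in> carrier R"
      using x y by (simp_all add: nonzerodivisors_def)
    have "z = \<zero>" if z: "z \<in> carrier R" "x \<otimes> y \<otimes> z = \<zero>" for z
    proof -
      have "x \<otimes> (y \<otimes> z) = \<zero>" "y \<otimes> z \<in> carrier R"
        using c z by (simp_all add: m_assoc)
      then have "y \<otimes> z = \<zero>"
        using x unfolding nonzerodivisors_def by blast
      then show ?thesis
        using y z(1) unfolding nonzerodivisors_def by blast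
    qed
    then show ?thesis
      using c by (simp add: nonzerodivisors_def)
  qed
  show "\<one> \<in> nonzerodivisors R"
    by (simp add: nonzerodivisors_def)
  show "nonzerodivisors R \<subseteq> carrier R"
    by (simp add: nonzerodivisors_def)
qed

lemma (in cring) cring_total_frac: "cring (total_frac R)"
  unfolding total_frac_def
  by (rule mult_set.cring_localization[OF mult_set_nonzerodivisors])

lemma (in cring) to_frac_hom: "to_frac R \<in> ring_hom R (total_frac R)"
proof -
  have one: "\<one> \<in> nonzerodivisors R"
    by (simp add: nonzerodivisors_def)
  interpret mult_set R "nonzerodivisors R" by (rule mult_set_nonzerodivisors)
  show ?thesis
    unfolding to_frac_def total_frac_def
  proof (rule ring_hom_memI)
    fix x y assume xy: "x \<in> carrier R" "y \<in> carrier R"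
    show "loc_frac R (nonzerodivisors R) x \<one> \<in> carrier (localization R (nonzerodivisors R))"
      using xy(1) one by (rule frac_in_carrier)
    show "loc_frac R (nonzerodivisors R) (x \<otimes> y) \<one> =
        loc_frac R (nonzerodivisors R) x \<one> \<otimes>\<^bsub>localization R (nonzerodivisors R)\<^esub>
        loc_frac R (nonzerodivisors R) y \<one>"
      using frac_mult[OF xy one one] by simp
    show "loc_frac R (nonzerodivisors R) (x \<oplus> y) \<one> =
        loc_frac R (nonzerodivisors R) x \<one> \<oplus>\<^bsub>localization R (nonzerodivisors R)\<^esub>
        loc_frac R (nonzerodivisors R) y \<one>"
      using frac_add[OF xy one one] xy by simp
  qed (rule localization_one[symmetric])
qed

lemma (in cring) inj_on_to_frac: "inj_on (to_frac R) (carrier R)"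
proof (rule inj_onI)
  interpret mult_set R "nonzerodivisors R" by (rule mult_set_nonzerodivisors)
  fix x y assume xy: "x \<in> carrier R" "y \<in> carrier R" "to_frac R x = to_frac R y"
  then obtain t where t: "t \<in> nonzerodivisors R" "t \<otimes> x = t \<otimes> y"
    by (auto simp: to_frac_def frac_eq_iff)
  have "t \<otimes> (x \<ominus> y) = \<zero>"
    using xy(1,2) t by (simp add: r_distr a_minus_def r_minus r_neg)
  moreover have "x \<ominus> y \<in> carrier R"
    using xy(1,2) by simp
  ultimately have "x \<ominus> y = \<zero>"
    using t(1) unfolding nonzerodivisors_def by blast
  then show "x = y"
    using xy(1,2) by simp
qed


section \<open>Trace ideals\<close>

definition module_dual ::
    "('a, 'b) ring_scheme \<Rightarrow> ('a, 'm, 'c) module_scheme \<Rightarrow> ('m \<Rightarrow> 'a) set" where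
  "module_dual R M = {f \<in> carrier M \<rightarrow> carrier R.
     (\<forall>x \<in> carrier M. \<forall>y \<in> carrier M. f (x \<oplus>\<^bsub>M\<^esub> y) = f x \<oplus>\<^bsub>R\<^esub> f y) \<and>
     (\<forall>r \<in> carrier R. \<forall>x \<in> carrier M. f (r \<odot>\<^bsub>M\<^esub> x) = r \<otimes>\<^bsub>R\<^esub> f x)}"

definition module_trace :: "('a, 'b) ring_scheme \<Rightarrow> ('a, 'm, 'c) module_scheme \<Rightarrow> 'a set" where
  "module_trace R M = Idl\<^bsub>R\<^esub> {f m | f m. f \<in> module_dual R M \<and> m \<in> carrier M}"

text \<open>Higher-order logic cannot quantify over the type of module elements inside a definition.
  It is enough to let \<open>M\<close> range over the modules whose elements have the same type as those of
  \<open>R\<close>: by \<open>trace_ideal_trace\<close>, the trace of a module of any other type is already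
  the trace of such a module.\<close>

definition trace_ideal :: "'a set \<Rightarrow> ('a, 'b) ring_scheme \<Rightarrow> bool" where
  "trace_ideal I R \<longleftrightarrow> (\<exists>M :: ('a, 'a) module. module R M \<and> I = module_trace R M)"

lemma (in cring) trace_ideal_trace:
  fixes M :: "('a, 'm, 'c) module_scheme"
  assumes "module R M"
  shows "trace_ideal (module_trace R M) R"
proof -
  interpret M: module R M by fact
  define G where "G = {f m | f m. f \<in> module_dual R M \<and> m \<in> carrier M}"
  define J where "J = Idl G"
  define N :: "('a, 'a) module" where
    "N = \<lparr> carrier = J, mult = mult R, one = one R, zero = \<zero>, add = add R, smult = mult R \<rparr>"
  have G: "G \<subseteq> carrier R"
    by (auto simp: G_def module_dual_def)
  interpret J: ideal J R
    unfolding J_def by (rule genideal_ideal[OF G])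
  have GJ: "G \<subseteq> J"
    unfolding J_def by (rule genideal_self[OF G])
  have sub: "J \<subseteq> carrier R"
    by (rule J.a_subset)
  have "abelian_group N"
  proof (rule abelian_groupI, goal_cases)
    case (6 x)
    then show ?case
      using J.a_inv_closed sub by (auto simp: N_def intro!: bexI[of _ "\<ominus> x"] l_neg)
  qed (use sub in \<open>auto simp: N_def a_ac subset_iff\<close>)
  then have N: "module R N"
    using sub
    by (intro moduleI cring_axioms)
      (auto simp: N_def subset_iff J.I_l_closed l_distr r_distr m_assoc)
  define H where "H = {g x | g x. g \<in> module_dual R N \<and> x \<in> carrier N}"
  have H: "H \<subseteq> carrier R"
    by (auto simp: H_def module_dual_def)
  have incl: "(\<lambda>x. x) \<in> module_dual R N"
    using sub by (auto simp: module_dual_def N_def)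
  have "J \<subseteq> H"
    using incl by (fastforce simp: H_def N_def)
  then have "J \<subseteq> Idl H"
    using genideal_self[OF H] by blast
  moreover have "H \<subseteq> J"
  proof -
    have "\<forall>g \<in> module_dual R N. g x \<in> J" if "x \<in> J" for x
    proof -
      let ?K = "{x \<in> J. \<forall>g \<in> module_dual R N. g x \<in> J}"
      have "ideal ?K R"
      proof (rule idealI[OF ring_axioms])
        have zero: "g \<zero> \<in> J" if "g \<in> module_dual R N" for g
        proof -
          have gJ: "g x \<in> carrier R" if "x \<in> J" for x
            using \<open>g \<in> module_dual R N\<close> that by (auto simp: module_dual_def N_def)
          have gs: "g (r \<otimes> x) = r \<otimes> g x" if "r \<in> carrier R" "x \<in> J" for r x
            using \<open>g \<in> module_dual R N\<close> that by (simp add: module_dual_def N_def)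
          show ?thesis
            using gs[OF zero_closed J.zero_closed] gJ[OF J.zero_closed] by simp
        qed
        have smul: "g (r \<otimes> x) \<in> J"
          if "g \<in> module_dual R N" "x \<in> J" "r \<in> carrier R" "g x \<in> J" for g r x
        proof -
          have "g (r \<otimes> x) = r \<otimes> g x"
            using that by (simp add: module_dual_def N_def)
          then show ?thesis using that by (simp add: J.I_l_closed)
        qed
        show "subgroup ?K (add_monoid R)"
        proof (rule add.subgroupI)
          show "\<ominus> x \<in> ?K" if "x \<in> ?K" for x
          proof -
            have "\<ominus> x = (\<ominus> \<one>) \<otimes> x" using that sub by (auto simp: l_minus)
            then show ?thesis using that smul[of _ x "\<ominus> \<one>"] J.I_l_closed[of x "\<ominus> \<one>"] by auto
          qed
          show "x \<oplus> y \<in> ?K" if "x \<in> ?K" "y \<in> ?K" for x y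
            using that by (auto simp: module_dual_def N_def)
          show "?K \<noteq> {}"
            using zero J.zero_closed by blast
        qed (use sub in auto)
        show "r \<otimes> x \<in> ?K" if "x \<in> ?K" "r \<in> carrier R" for x r
          using that smul J.I_l_closed by auto
        show "x \<otimes> r \<in> ?K" if "x \<in> ?K" "r \<in> carrier R" for x r
        proof -
          have "x \<otimes> r = r \<otimes> x" using that sub by (auto simp: m_comm)
          then show ?thesis using that smul J.I_l_closed by auto
        qed
      qed
      moreover have "G \<subseteq> ?K"
      proof
        fix y assume "y \<in> G"
        then obtain f m where f: "f \<in> module_dual R M" "m \<in> carrier M" "y = f m"
          by (auto simp: G_def)
        have fJ: "f z \<in> J" if "z \<in> carrier M" for z
          using f(1) that GJ by (auto simp: G_def)
        have "g \<circ> f \<in> module_dual R M" if "g \<in> module_dual R N" for g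
          using that f(1) fJ by (auto simp: module_dual_def N_def Pi_iff)
        then show "y \<in> ?K"
          using f GJ \<open>y \<in> G\<close> by (fastforce simp: G_def)
      qed
      ultimately have "J \<subseteq> ?K"
        unfolding J_def by (rule genideal_minimal)
      then show ?thesis using that by auto
    qed
    then show ?thesis by (auto simp: H_def N_def)
  qed
  then have "Idl H \<subseteq> J"
    by (rule genideal_minimal[OF J.ideal_axioms])
  ultimately have "module_trace R M = module_trace R N"
    unfolding module_trace_def G_def[symmetric] H_def[symmetric] J_def[symmetric] by blast
  then show ?thesis
    using N unfolding trace_ideal_def by blast
qed


section \<open>Colons, the three sets and the three maps\<close>

definition colon ::
    "('a, 'b) ring_scheme \<Rightarrow> ('a \<times> 'a) set set \<Rightarrow> ('a \<times> 'a) set set \<Rightarrow> ('a \<times> 'a) set set" where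
  "colon R M N = {a \<in> carrier (total_frac R). a <#\<^bsub>total_frac R\<^esub> N \<subseteq> M}"

definition regular_ideals :: "('a, 'b) ring_scheme \<Rightarrow> 'a set set" where
  "regular_ideals R = {I. ideal I R \<and> I \<inter> nonzerodivisors R \<noteq> {}}"

definition X_set :: "('a, 'b) ring_scheme \<Rightarrow> 'a set set" where
  "X_set R = {I \<in> regular_ideals R. trace_ideal I R}"

definition Y_set :: "('a, 'b) ring_scheme \<Rightarrow> ('a \<times> 'a) set set set" where
  "Y_set R = {A. subring A (total_frac R) \<and> to_frac R ` carrier R \<subseteq> A \<and>
     (\<exists>a \<in> nonzerodivisors R. to_frac R a <#\<^bsub>total_frac R\<^esub> A \<subseteq> to_frac R ` carrier R)}"

definition Z_set :: "('a, 'b) ring_scheme \<Rightarrow> 'a set set" where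
  "Z_set R = {I \<in> regular_ideals R. \<exists>a \<in> I. I \<cdot>\<^bsub>R\<^esub> I = a <#\<^bsub>R\<^esub> I}"

text \<open>Ideals are subsets of \<open>R\<close> itself, so they enter colons through their image under
  \<open>to_frac R\<close>, and \<open>R : A\<close>, which lies in that image, is pulled back to \<open>R\<close>
  by \<open>eta\<close>.\<close>

definition xi :: "('a, 'b) ring_scheme \<Rightarrow> 'a set \<Rightarrow> ('a \<times> 'a) set set" where
  "xi R I = colon R (to_frac R ` I) (to_frac R ` I)"

definition rho :: "('a, 'b) ring_scheme \<Rightarrow> 'a set \<Rightarrow> ('a \<times> 'a) set set" where
  "rho R I = colon R (to_frac R ` I) (to_frac R ` I)"

definition eta :: "('a, 'b) ring_scheme \<Rightarrow> ('a \<times> 'a) set set \<Rightarrow> 'a set" where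
  "eta R A = {r \<in> carrier R. to_frac R r \<in> colon R (to_frac R ` carrier R) A}"

lemma (in cring) to_frac_image_eta:
  assumes "A \<in> Y_set R"
  shows "to_frac R ` eta R A = colon R (to_frac R ` carrier R) A"
proof -
  interpret Q: cring "total_frac R" by (rule cring_total_frac)
  have "a \<in> to_frac R ` carrier R" if a: "a \<in> colon R (to_frac R ` carrier R) A" for a
  proof -
    have aQ: "a \<in> carrier (total_frac R)"
      and sub: "a <#\<^bsub>total_frac R\<^esub> A \<subseteq> to_frac R ` carrier R"
      using a unfolding colon_def by blast+
    have "\<one>\<^bsub>total_frac R\<^esub> \<in> A"
      using assms subringE(3) unfolding Y_set_def by blast
    then have "a \<otimes>\<^bsub>total_frac R\<^esub> \<one>\<^bsub>total_frac R\<^esub> \<in> to_frac R ` carrier R"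
      using sub unfolding l_coset_def by blast
    then show ?thesis
      using aQ by simp
  qed
  then show ?thesis
    unfolding eta_def by blast
qed

end

theory Submission
  imports Defs
begin

text \<open>
  Write \<open>Q\<close> for the total ring of fractions and identify \<open>R\<close> with its image in \<open>Q\<close>.

  For the surjectivity of \<open>\<xi>\<close>, a ring \<open>A\<close> with \<open>aA \<subseteq> R\<close> is recovered from the ideal
  \<open>I = aA\<close>: since \<open>a\<close> is a unit of \<open>Q\<close>, multiplication by \<open>a\<close> changes no colon, so
  \<open>I : I = A : A = A\<close>, and \<open>I\<^sup>2 = a\<^sup>2A = aI\<close>.

  The equivalences rest on a description of the trace ideals that does not mention modules: a
  regular ideal \<open>I\<close> is a trace ideal iff \<open>R : I = I : I\<close> (\<open>regular_trace_ideal_iff\<close>). The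
  reason is that an \<open>R\<close>-linear map \<open>I \<rightarrow> R\<close> on a regular ideal is multiplication by an element of
  \<open>R : I\<close>. In particular \<open>\<rho>(I) = R : I\<close> on trace ideals, so \<open>\<rho>\<close> and \<open>\<eta>\<close> are both given by
  the operation \<open>X \<mapsto> R : X\<close>, which is an antitone Galois connection of the subsets of \<open>Q\<close> with
  itself. Everything else is formal. Sets of the form \<open>R : X\<close> are fixed by \<open>R : (R : _)\<close>, so
  every value of \<open>\<rho>\<close> is reflexive, meaning \<open>A = R : (R : A)\<close>; conversely a reflexive \<open>A\<close> is
  \<open>\<rho>(\<eta>(A))\<close>. Moreover \<open>A\<close> and \<open>R : (R : A) = \<rho>(\<eta>(A))\<close> always have the same image under \<open>\<eta>\<close>,
  so \<open>\<eta>\<close> is injective exactly when they coincide for every \<open>A\<close>.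
\<close>

section \<open>A criterion for ideals\<close>

lemma (in cring) ideal_of_closed:
  assumes sub: "J \<subseteq> carrier R" and ne: "J \<noteq> {}"
    and add: "\<And>x y. \<lbrakk>x \<in> J; y \<in> J\<rbrakk> \<Longrightarrow> x \<oplus> y \<in> J"
    and mult: "\<And>x r. \<lbrakk>x \<in> J; r \<in> carrier R\<rbrakk> \<Longrightarrow> r \<otimes> x \<in> J"
  shows "ideal J R"
proof (rule idealI[OF ring_axioms])
  show "subgroup J (add_monoid R)"
  proof (rule add.subgroupI[OF sub ne _ add])
    show "\<ominus> x \<in> J" if "x \<in> J" for x
    proof -
      have "\<ominus> x = (\<ominus> \<one>) \<otimes> x" using that sub by (auto simp: l_minus)
      then show ?thesis using mult[OF that, of "\<ominus> \<one>"] by simp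
    qed
  qed
  show "x \<otimes> r \<in> J" if "x \<in> J" "r \<in> carrier R" for x r
    using mult[OF that] that sub by (auto simp: m_comm)
qed (rule mult)


section \<open>The canonical map into the total ring of fractions\<close>

locale total_fractions = cring R for R (structure)
begin

sublocale Q: cring "total_frac R"
  by (rule cring_total_frac)

abbreviation "Q \<equiv> total_frac R"
abbreviation "\<phi> \<equiv> to_frac R"
abbreviation "W \<equiv> nonzerodivisors R"
abbreviation "K \<equiv> to_frac R ` carrier R"

sublocale phi: ring_hom_cring R Q \<phi>
  by (intro ring_hom_cringI to_frac_hom cring_axioms Q.cring_axioms)

lemma phi_eq_iff [simp]: "\<lbrakk>x \<in> carrier R; y \<in> carrier R\<rbrakk> \<Longrightarrow> \<phi> x = \<phi> y \<longleftrightarrow> x = y"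
  using inj_on_to_frac by (auto dest: inj_onD)

lemma phi_in_image_iff [simp]:
  assumes "r \<in> carrier R" "I \<subseteq> carrier R"
  shows "\<phi> r \<in> \<phi> ` I \<longleftrightarrow> r \<in> I"
  using inj_on_image_mem_iff[OF inj_on_to_frac assms(1,2)] .

lemma nonzerodivisors_carrier: "w \<in> W \<Longrightarrow> w \<in> carrier R"
  by (simp add: nonzerodivisors_def)

lemma phi_nonzerodivisor_Units:
  assumes w: "w \<in> W"
  shows "\<phi> w \<in> Units Q"
proof -
  interpret mult_set R W by (rule mult_set_nonzerodivisors)
  note wR = nonzerodivisors_carrier[OF w]
  let ?v = "loc_frac R W \<one> w"
  have vQ: "?v \<in> carrier Q"
    unfolding total_frac_def using w by (intro frac_in_carrier) auto
  have "?v \<otimes>\<^bsub>Q\<^esub> \<phi> w = loc_frac R W (\<one> \<otimes> w) (w \<otimes> \<one>)"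
    unfolding total_frac_def to_frac_def using w wR by (intro frac_mult) auto
  also have "\<dots> = loc_frac R W \<one> \<one>"
    using w wR by (intro frac_eqI) auto
  also have "\<dots> = \<one>\<^bsub>Q\<^esub>"
    by (simp add: total_frac_def localization_one)
  finally have "?v \<otimes>\<^bsub>Q\<^esub> \<phi> w = \<one>\<^bsub>Q\<^esub>" .
  moreover from this have "\<phi> w \<otimes>\<^bsub>Q\<^esub> ?v = \<one>\<^bsub>Q\<^esub>"
    using vQ wR by (simp add: Q.m_comm)
  ultimately show ?thesis
    using vQ wR by (auto simp: Units_def)
qed

lemma phi_nonzerodivisor_cancel:
  assumes "w \<in> W" "x \<in> carrier Q" "y \<in> carrier Q" "\<phi> w \<otimes>\<^bsub>Q\<^esub> x = \<phi> w \<otimes>\<^bsub>Q\<^esub> y"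
  shows "x = y"
  using assms Q.Units_l_cancel[OF phi_nonzerodivisor_Units] by blast


section \<open>Colons\<close>

lemma colon_iff: "x \<in> colon R M N \<longleftrightarrow> x \<in> carrier Q \<and> (\<forall>n \<in> N. x \<otimes>\<^bsub>Q\<^esub> n \<in> M)"
  by (auto simp: colon_def l_coset_def)

lemma colon_antimono: "N \<subseteq> N' \<Longrightarrow> colon R M N' \<subseteq> colon R M N"
  unfolding subset_iff colon_iff by blast

lemma colon_mono: "M \<subseteq> M' \<Longrightarrow> colon R M N \<subseteq> colon R M' N"
  unfolding subset_iff colon_iff by blast

lemma colon_carrier: "colon R M N \<subseteq> carrier Q"
  by (auto simp: colon_iff)

lemma subset_colon_colon:
  assumes "N \<subseteq> carrier Q"
  shows "N \<subseteq> colon R M (colon R M N)"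
proof
  fix n assume n: "n \<in> N"
  then have nQ: "n \<in> carrier Q" using assms by blast
  have "n \<otimes>\<^bsub>Q\<^esub> x \<in> M" if "x \<in> colon R M N" for x
    using that n nQ Q.m_comm[of n x] by (simp add: colon_iff)
  then show "n \<in> colon R M (colon R M N)"
    using nQ unfolding colon_iff[of n] by blast
qed

lemma colon_colon_colon:
  assumes "N \<subseteq> carrier Q"
  shows "colon R M (colon R M (colon R M N)) = colon R M N"
proof (rule subset_antisym)
  show "colon R M (colon R M (colon R M N)) \<subseteq> colon R M N"
    by (intro colon_antimono subset_colon_colon assms)
  show "colon R M N \<subseteq> colon R M (colon R M (colon R M N))"
    by (intro subset_colon_colon colon_carrier)
qed

lemma Y_setD:
  assumes "A \<in> Y_set R"
  shows "subring A Q" "K \<subseteq> A"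
  using assms by (auto simp: Y_set_def)

lemma Y_set_carrier: "A \<in> Y_set R \<Longrightarrow> A \<subseteq> carrier Q"
  using Y_setD(1) subringE(1) by blast

lemma regular_idealD: "I \<in> regular_ideals R \<Longrightarrow> ideal I R"
  by (simp add: regular_ideals_def)

text \<open>The map \<open>I \<mapsto> I : I\<close> takes values in \<open>Y_set R\<close>: a regular element \<open>a\<close> of \<open>I\<close> is a common
  denominator, because \<open>a(I : I) \<subseteq> I \<subseteq> R\<close>.\<close>

lemma self_colon_in_Y_set:
  assumes I: "I \<in> regular_ideals R"
  shows "colon R (\<phi> ` I) (\<phi> ` I) \<in> Y_set R" (is "?A \<in> _")
proof -
  interpret I: ideal I R by (rule regular_idealD[OF I])
  obtain a where a: "a \<in> I" "a \<in> W"
    using I by (auto simp: regular_ideals_def)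
  have "subring ?A Q"
  proof (rule Q.subringI)
    show "\<ominus>\<^bsub>Q\<^esub> h \<in> ?A" if h: "h \<in> ?A" for h
    proof -
      have "(\<ominus>\<^bsub>Q\<^esub> h) \<otimes>\<^bsub>Q\<^esub> \<phi> i \<in> \<phi> ` I" if i: "i \<in> I" for i
      proof -
        obtain j where j: "j \<in> I" "h \<otimes>\<^bsub>Q\<^esub> \<phi> i = \<phi> j"
          using h i unfolding colon_iff by blast
        then have "(\<ominus>\<^bsub>Q\<^esub> h) \<otimes>\<^bsub>Q\<^esub> \<phi> i = \<phi> (\<ominus> j)"
          using h i by (simp add: colon_iff Q.l_minus I.Icarr)
        also have "\<dots> \<in> \<phi> ` I" using j(1) by (intro imageI I.a_inv_closed)
        finally show ?thesis .
      qed
      then show ?thesis using h by (simp add: colon_iff)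
    qed
    show "h \<otimes>\<^bsub>Q\<^esub> h' \<in> ?A" if h: "h \<in> ?A" and h': "h' \<in> ?A" for h h'
    proof -
      have "h \<otimes>\<^bsub>Q\<^esub> h' \<otimes>\<^bsub>Q\<^esub> \<phi> i \<in> \<phi> ` I" if i: "i \<in> I" for i
      proof -
        have "h \<otimes>\<^bsub>Q\<^esub> (h' \<otimes>\<^bsub>Q\<^esub> \<phi> i) \<in> \<phi> ` I"
          using h h' i unfolding colon_iff by blast
        then show ?thesis
          using h h' i by (simp add: colon_iff Q.m_assoc I.Icarr)
      qed
      then show ?thesis using h h' by (simp add: colon_iff)
    qed
    show "h \<oplus>\<^bsub>Q\<^esub> h' \<in> ?A" if h: "h \<in> ?A" and h': "h' \<in> ?A" for h h'
    proof -
      have "(h \<oplus>\<^bsub>Q\<^esub> h') \<otimes>\<^bsub>Q\<^esub> \<phi> i \<in> \<phi> ` I" if i: "i \<in> I" for i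
      proof -
        obtain j where j: "j \<in> I" "h \<otimes>\<^bsub>Q\<^esub> \<phi> i = \<phi> j"
          using h i unfolding colon_iff by blast
        obtain j' where j': "j' \<in> I" "h' \<otimes>\<^bsub>Q\<^esub> \<phi> i = \<phi> j'"
          using h' i unfolding colon_iff by blast
        have "(h \<oplus>\<^bsub>Q\<^esub> h') \<otimes>\<^bsub>Q\<^esub> \<phi> i = \<phi> (j \<oplus> j')"
          using h h' i j j' by (simp add: colon_iff Q.l_distr I.Icarr)
        also have "\<dots> \<in> \<phi> ` I" using j(1) j'(1) by (intro imageI I.a_closed)
        finally show ?thesis .
      qed
      then show ?thesis using h h' by (simp add: colon_iff)
    qed
  qed (auto simp: colon_iff I.Icarr)
  moreover have "K \<subseteq> ?A"
  proof
    fix x assume "x \<in> K"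
    then obtain r where r: "r \<in> carrier R" "x = \<phi> r" by auto
    have "\<phi> r \<otimes>\<^bsub>Q\<^esub> \<phi> i \<in> \<phi> ` I" if i: "i \<in> I" for i
    proof -
      have "\<phi> r \<otimes>\<^bsub>Q\<^esub> \<phi> i = \<phi> (r \<otimes> i)"
        using r i by (simp add: I.Icarr)
      also have "\<dots> \<in> \<phi> ` I" using r(1) i by (intro imageI I.I_l_closed)
      finally show ?thesis .
    qed
    then show "x \<in> ?A" using r by (simp add: colon_iff)
  qed
  moreover have "\<phi> a <#\<^bsub>Q\<^esub> ?A \<subseteq> K"
  proof -
    have "\<phi> a \<otimes>\<^bsub>Q\<^esub> x \<in> K" if x: "x \<in> ?A" for x
    proof -
      have "\<phi> a \<otimes>\<^bsub>Q\<^esub> x = x \<otimes>\<^bsub>Q\<^esub> \<phi> a"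
        using x a(1) by (simp add: colon_iff Q.m_comm I.Icarr)
      also have "\<dots> \<in> \<phi> ` I" using x a(1) by (simp add: colon_iff)
      also have "\<phi> ` I \<subseteq> K" using I.a_subset by blast
      finally show ?thesis .
    qed
    then show ?thesis by (auto simp: l_coset_def)
  qed
  ultimately show ?thesis
    using a(2) by (auto simp: Y_set_def)
qed


section \<open>Surjectivity of \<open>\<xi>\<close>\<close>

text \<open>The preimage is \<open>I = aA\<close> for a common denominator \<open>a\<close> of \<open>A\<close>. It lies in \<open>R\<close> by the choice
  of \<open>a\<close>, and it contains the regular element \<open>a\<close> because \<open>1 \<in> A\<close>.\<close>

lemma xi_surj:
  assumes A: "A \<in> Y_set R"
  obtains I where "I \<in> Z_set R" "xi R I = A"
proof -
  note sub = Y_setD(1)[OF A]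
  note AQ = subsetD[OF Y_set_carrier[OF A]]
  obtain a where a: "a \<in> W" and aA: "\<phi> a <#\<^bsub>Q\<^esub> A \<subseteq> K"
    using A by (auto simp: Y_set_def)
  note aR = nonzerodivisors_carrier[OF a]
  let ?M = "\<phi> a <#\<^bsub>Q\<^esub> A"
  define I where "I = {r \<in> carrier R. \<phi> r \<in> ?M}"
  have M_iff: "x \<in> ?M \<longleftrightarrow> (\<exists>\<alpha> \<in> A. x = \<phi> a \<otimes>\<^bsub>Q\<^esub> \<alpha>)" for x
    by (auto simp: l_coset_def)
  have img: "\<phi> ` I = ?M"
    using aA by (auto simp: I_def)
  have M_add: "x \<oplus>\<^bsub>Q\<^esub> y \<in> ?M" if "x \<in> ?M" "y \<in> ?M" for x y
  proof -
    obtain \<alpha> \<beta> where h: "\<alpha> \<in> A" "x = \<phi> a \<otimes>\<^bsub>Q\<^esub> \<alpha>" "\<beta> \<in> A" "y = \<phi> a \<otimes>\<^bsub>Q\<^esub> \<beta>"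
      using \<open>x \<in> ?M\<close> \<open>y \<in> ?M\<close> unfolding M_iff by blast
    then have "x \<oplus>\<^bsub>Q\<^esub> y = \<phi> a \<otimes>\<^bsub>Q\<^esub> (\<alpha> \<oplus>\<^bsub>Q\<^esub> \<beta>)"
      using aR by (simp add: Q.r_distr AQ)
    then show ?thesis using h subringE(7)[OF sub] M_iff by blast
  qed
  have M_mult: "\<alpha> \<otimes>\<^bsub>Q\<^esub> x \<in> ?M" if "\<alpha> \<in> A" "x \<in> ?M" for \<alpha> x
  proof -
    obtain \<beta> where h: "\<beta> \<in> A" "x = \<phi> a \<otimes>\<^bsub>Q\<^esub> \<beta>"
      using \<open>x \<in> ?M\<close> unfolding M_iff by blast
    then have "\<alpha> \<otimes>\<^bsub>Q\<^esub> x = \<phi> a \<otimes>\<^bsub>Q\<^esub> (\<alpha> \<otimes>\<^bsub>Q\<^esub> \<beta>)"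
      using aR \<open>\<alpha> \<in> A\<close> by (simp add: Q.m_lcomm AQ)
    then show ?thesis using h \<open>\<alpha> \<in> A\<close> subringE(6)[OF sub] M_iff by blast
  qed
  have KA: "\<phi> r \<in> A" if "r \<in> carrier R" for r
    using Y_setD(2)[OF A] that by blast
  have I_l: "r \<otimes> x \<in> I" if "x \<in> I" "r \<in> carrier R" for x r
    using M_mult[OF KA[OF that(2)], of "\<phi> x"] that by (simp add: I_def)
  have "\<phi> a = \<phi> a \<otimes>\<^bsub>Q\<^esub> \<one>\<^bsub>Q\<^esub>"
    using aR by simp
  then have "\<phi> a \<in> ?M"
    using subringE(3)[OF sub] M_iff by blast
  then have aI: "a \<in> I"
    using aR by (simp add: I_def)
  have I: "ideal I R"
  proof (rule ideal_of_closed)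
    show "x \<oplus> y \<in> I" if "x \<in> I" "y \<in> I" for x y
      using M_add[of "\<phi> x" "\<phi> y"] that by (simp add: I_def)
  qed (use aI I_l in \<open>unfold I_def, blast+\<close>)
  interpret I: ideal I R by (rule I)
  have "I \<cdot> I = a <# I"
  proof
    show "I \<cdot> I \<subseteq> a <# I"
    proof
      fix s assume "s \<in> I \<cdot> I"
      then show "s \<in> a <# I"
      proof (induction rule: ideal_prod.induct)
        case (prod i j)
        \<comment> \<open>With \<open>i = a\<alpha>\<close> and \<open>\<alpha> \<in> A\<close>, the product is \<open>ij = a(\<alpha>j)\<close>, and \<open>\<alpha>j\<close> stays in \<open>I\<close>.\<close>
        obtain \<alpha> where \<alpha>: "\<alpha> \<in> A" "\<phi> i = \<phi> a \<otimes>\<^bsub>Q\<^esub> \<alpha>"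
          using prod(1) unfolding I_def M_iff by blast
        have "\<alpha> \<otimes>\<^bsub>Q\<^esub> \<phi> j \<in> ?M"
          using M_mult[OF \<alpha>(1)] prod(2) unfolding I_def by blast
        then obtain k where k: "k \<in> I" "\<alpha> \<otimes>\<^bsub>Q\<^esub> \<phi> j = \<phi> k"
          using img by blast
        have "\<phi> (i \<otimes> j) = \<phi> a \<otimes>\<^bsub>Q\<^esub> (\<alpha> \<otimes>\<^bsub>Q\<^esub> \<phi> j)"
          using \<alpha> prod aR by (simp add: I.Icarr AQ Q.m_assoc)
        also have "\<dots> = \<phi> (a \<otimes> k)"
          using k aR by (simp add: I.Icarr)
        finally have "i \<otimes> j = a \<otimes> k"
          using prod k aR by (simp add: I.Icarr del: phi.hom_mult)
        then show ?case using k(1) by (auto simp: l_coset_def)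
      next
        case (sum s t)
        then obtain k l where h: "k \<in> I" "s = a \<otimes> k" "l \<in> I" "t = a \<otimes> l"
          by (auto simp: l_coset_def)
        then have "s \<oplus> t = a \<otimes> (k \<oplus> l)"
          using aR by (simp add: r_distr I.Icarr)
        then show ?case using h by (auto simp: l_coset_def)
      qed
    qed
    show "a <# I \<subseteq> I \<cdot> I"
      using aI by (auto simp: l_coset_def intro: ideal_prod.prod)
  qed
  then have "I \<in> Z_set R"
    using I aI a by (auto simp: Z_set_def regular_ideals_def)
  moreover have "colon R ?M ?M = A"
  proof
    show "colon R ?M ?M \<subseteq> A"
    proof
      fix x assume x: "x \<in> colon R ?M ?M"
      then have "x \<otimes>\<^bsub>Q\<^esub> \<phi> a \<in> ?M"
        using aI img unfolding colon_iff by blast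
      then obtain \<alpha> where \<alpha>: "\<alpha> \<in> A" "x \<otimes>\<^bsub>Q\<^esub> \<phi> a = \<phi> a \<otimes>\<^bsub>Q\<^esub> \<alpha>"
        using M_iff by blast
      moreover have xQ: "x \<in> carrier Q" using x by (simp add: colon_iff)
      ultimately have "\<phi> a \<otimes>\<^bsub>Q\<^esub> x = \<phi> a \<otimes>\<^bsub>Q\<^esub> \<alpha>"
        using aR by (simp add: Q.m_comm)
      then have "x = \<alpha>"
        using phi_nonzerodivisor_cancel[OF a xQ] AQ \<alpha>(1) by blast
      then show "x \<in> A" using \<alpha>(1) by simp
    qed
    show "A \<subseteq> colon R ?M ?M"
      unfolding subset_iff colon_iff using M_mult AQ by blast
  qed
  ultimately show thesis
    using that img by (simp add: xi_def)
qed


section \<open>Regular trace ideals\<close>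

text \<open>Multiplication by \<open>x \<in> R : \<tau>(M)\<close> turns a functional \<open>f\<close> on \<open>M\<close> into another functional
  \<open>xf\<close> with values in \<open>R\<close>, so it maps the generators \<open>f m\<close> of the trace into the trace.\<close>

lemma trace_ideal_colon:
  assumes tr: "trace_ideal I R"
  shows "colon R K (\<phi> ` I) = colon R (\<phi> ` I) (\<phi> ` I)"
proof
  obtain M :: "('a, 'a) module" where M: "module R M" and IM: "I = module_trace R M"
    using tr unfolding trace_ideal_def by blast
  interpret M: module R M by (rule M)
  let ?G = "{f m | f m. f \<in> module_dual R M \<and> m \<in> carrier M}"
  have G: "?G \<subseteq> carrier R" by (auto simp: module_dual_def)
  have I_eq: "I = Idl ?G" by (simp add: IM module_trace_def)
  interpret I: ideal I R
    unfolding I_eq by (rule genideal_ideal[OF G])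
  have GI: "?G \<subseteq> I" unfolding I_eq by (rule genideal_self[OF G])
  show "colon R (\<phi> ` I) (\<phi> ` I) \<subseteq> colon R K (\<phi> ` I)"
    using I.a_subset by (intro colon_mono image_mono)
  show "colon R K (\<phi> ` I) \<subseteq> colon R (\<phi> ` I) (\<phi> ` I)"
  proof
    fix x assume x: "x \<in> colon R K (\<phi> ` I)"
    then have xQ: "x \<in> carrier Q" by (simp add: colon_iff)
    let ?J = "{r \<in> carrier R. x \<otimes>\<^bsub>Q\<^esub> \<phi> r \<in> \<phi> ` I}"
    have J_l: "s \<otimes> r \<in> ?J" if r: "r \<in> ?J" and s: "s \<in> carrier R" for r s
    proof -
      obtain i where i: "i \<in> I" "x \<otimes>\<^bsub>Q\<^esub> \<phi> r = \<phi> i" using r by auto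
      then have "x \<otimes>\<^bsub>Q\<^esub> \<phi> (s \<otimes> r) = \<phi> (s \<otimes> i)"
        using r s xQ Q.m_lcomm[of x "\<phi> s" "\<phi> r"] by (simp add: I.Icarr)
      also have "\<dots> \<in> \<phi> ` I" using i(1) s by (intro imageI I.I_l_closed)
      finally show ?thesis using r s by simp
    qed
    have J: "ideal ?J R"
    proof (rule ideal_of_closed)
      show "r \<oplus> s \<in> ?J" if r: "r \<in> ?J" and s: "s \<in> ?J" for r s
      proof -
        obtain i j where i: "i \<in> I" "x \<otimes>\<^bsub>Q\<^esub> \<phi> r = \<phi> i" and j: "j \<in> I" "x \<otimes>\<^bsub>Q\<^esub> \<phi> s = \<phi> j"
          using r s by auto
        then have "x \<otimes>\<^bsub>Q\<^esub> \<phi> (r \<oplus> s) = \<phi> (i \<oplus> j)"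
          using r s xQ by (simp add: Q.r_distr I.Icarr)
        also have "\<dots> \<in> \<phi> ` I" using i(1) j(1) by (intro imageI I.a_closed)
        finally show ?thesis using r s by simp
      qed
      have "x \<otimes>\<^bsub>Q\<^esub> \<phi> \<zero> = \<phi> \<zero>" using xQ by simp
      then show "?J \<noteq> {}" using I.zero_closed by blast
    qed (use J_l in blast)+
    have "?G \<subseteq> ?J"
    proof
      fix y assume y: "y \<in> ?G"
      then obtain f m where f: "f \<in> module_dual R M" and m: "m \<in> carrier M" and ym: "y = f m"
        by auto
      have fI: "f n \<in> I" if "n \<in> carrier M" for n
        using f that GI by auto
      \<comment> \<open>The functional \<open>xf\<close>, with values pulled back from \<open>Q\<close> to \<open>R\<close>.\<close>
      define g where "g n = inv_into (carrier R) \<phi> (x \<otimes>\<^bsub>Q\<^esub> \<phi> (f n))" for n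
      have xf: "x \<otimes>\<^bsub>Q\<^esub> \<phi> (f n) \<in> K" if "n \<in> carrier M" for n
        using x fI[OF that] by (simp add: colon_iff)
      have gR: "g n \<in> carrier R" if "n \<in> carrier M" for n
        unfolding g_def using xf[OF that] by (rule inv_into_into)
      have phi_g: "\<phi> (g n) = x \<otimes>\<^bsub>Q\<^esub> \<phi> (f n)" if "n \<in> carrier M" for n
        unfolding g_def using xf[OF that] by (rule f_inv_into_f)
      have "g \<in> module_dual R M"
      proof -
        have "g (n \<oplus>\<^bsub>M\<^esub> n') = g n \<oplus> g n'" if n: "n \<in> carrier M" "n' \<in> carrier M" for n n'
        proof -
          have "f (n \<oplus>\<^bsub>M\<^esub> n') = f n \<oplus> f n'"
            using f n by (simp add: module_dual_def)
          then have "\<phi> (g (n \<oplus>\<^bsub>M\<^esub> n')) = \<phi> (g n \<oplus> g n')"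
            using n xQ fI by (simp add: phi_g gR I.Icarr Q.r_distr)
          then show ?thesis using n gR by (simp del: phi.hom_add)
        qed
        moreover have "g (r \<odot>\<^bsub>M\<^esub> n) = r \<otimes> g n" if n: "r \<in> carrier R" "n \<in> carrier M" for r n
        proof -
          have "f (r \<odot>\<^bsub>M\<^esub> n) = r \<otimes> f n"
            using f n by (simp add: module_dual_def)
          then have "\<phi> (g (r \<odot>\<^bsub>M\<^esub> n)) = \<phi> (r \<otimes> g n)"
            using n xQ fI by (simp add: phi_g gR I.Icarr Q.m_lcomm)
          then show ?thesis using n gR by (simp del: phi.hom_mult)
        qed
        ultimately show ?thesis using gR by (simp add: module_dual_def)
      qed
      then have "g m \<in> I" using GI m by blast
      then have "x \<otimes>\<^bsub>Q\<^esub> \<phi> y \<in> \<phi> ` I"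
        using phi_g[OF m] ym by (metis imageI)
      then show "y \<in> ?J" using y G by auto
    qed
    then have "I \<subseteq> ?J"
      unfolding I_eq using genideal_minimal[OF J[unfolded I_eq]] by simp
    then show "x \<in> colon R (\<phi> ` I) (\<phi> ` I)"
      using xQ by (auto simp: colon_iff)
  qed
qed

text \<open>Let \<open>a \<in> I\<close> be a regular element and \<open>f : I \<rightarrow> R\<close> linear. From \<open>f(i)a = f(ia) = i f(a)\<close> the
  map \<open>f\<close> is multiplication by \<open>q = f(a)/a \<in> R : I\<close>. Hence \<open>R : I = I : I\<close> forces all values of
  \<open>f\<close> into \<open>I\<close>, while the inclusion \<open>I \<rightarrow> R\<close> attains all of \<open>I\<close>: the module \<open>I\<close> has trace
  \<open>I\<close>.\<close>

lemma regular_trace_ideal_iff: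
  assumes reg: "I \<in> regular_ideals R"
  shows "trace_ideal I R \<longleftrightarrow> colon R K (\<phi> ` I) = colon R (\<phi> ` I) (\<phi> ` I)"
proof
  assume eq: "colon R K (\<phi> ` I) = colon R (\<phi> ` I) (\<phi> ` I)"
  interpret I: ideal I R by (rule regular_idealD[OF reg])
  obtain a where a: "a \<in> I" "a \<in> W"
    using reg by (auto simp: regular_ideals_def)
  note aR = I.Icarr[OF a(1)]
  define N :: "('a, 'a) module" where
    "N = \<lparr> carrier = I, mult = mult R, one = one R, zero = \<zero>, add = add R, smult = mult R \<rparr>"
  have "abelian_group N"
  proof (rule abelian_groupI, goal_cases)
    case (6 x)
    then show ?case
      by (auto simp: N_def I.Icarr intro!: bexI[of _ "\<ominus> x"] l_neg)
  qed (auto simp: N_def I.Icarr a_ac)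
  then have N: "module R N"
    by (intro moduleI cring_axioms)
      (auto simp: N_def I.Icarr I.I_l_closed l_distr r_distr m_assoc)
  have "f i \<in> I" if f: "f \<in> module_dual R N" and i: "i \<in> I" for f i
  proof -
    have fR: "f j \<in> carrier R" if "j \<in> I" for j
      using f that by (auto simp: module_dual_def N_def)
    have fs: "f (r \<otimes> j) = r \<otimes> f j" if "r \<in> carrier R" "j \<in> I" for r j
      using f that by (auto simp: module_dual_def N_def)
    note aU = phi_nonzerodivisor_Units[OF a(2)]
    define q where "q = inv\<^bsub>Q\<^esub> (\<phi> a) \<otimes>\<^bsub>Q\<^esub> \<phi> (f a)"
    have qQ: "q \<in> carrier Q"
      unfolding q_def using aU fR[OF a(1)] by simp
    have q: "q \<otimes>\<^bsub>Q\<^esub> \<phi> j = \<phi> (f j)" if j: "j \<in> I" for j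
    proof (rule phi_nonzerodivisor_cancel[OF a(2)])
      have "\<phi> a \<otimes>\<^bsub>Q\<^esub> q = \<phi> a \<otimes>\<^bsub>Q\<^esub> inv\<^bsub>Q\<^esub> (\<phi> a) \<otimes>\<^bsub>Q\<^esub> \<phi> (f a)"
        unfolding q_def using aU aR fR[OF a(1)] by (simp add: Q.m_assoc[symmetric])
      then have aq: "\<phi> a \<otimes>\<^bsub>Q\<^esub> q = \<phi> (f a)"
        using aU fR[OF a(1)] by simp
      have "\<phi> a \<otimes>\<^bsub>Q\<^esub> (q \<otimes>\<^bsub>Q\<^esub> \<phi> j) = \<phi> a \<otimes>\<^bsub>Q\<^esub> q \<otimes>\<^bsub>Q\<^esub> \<phi> j"
        using qQ aR j by (simp add: Q.m_assoc I.Icarr)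
      also have "\<dots> = \<phi> (j \<otimes> f a)"
        using aq fR[OF a(1)] j by (simp add: Q.m_comm I.Icarr)
      also have "j \<otimes> f a = a \<otimes> f j"
        using fs[of j a] fs[of a j] a(1) j aR by (simp add: I.Icarr m_comm)
      finally show "\<phi> a \<otimes>\<^bsub>Q\<^esub> (q \<otimes>\<^bsub>Q\<^esub> \<phi> j) = \<phi> a \<otimes>\<^bsub>Q\<^esub> \<phi> (f j)"
        using aR fR[OF j] by simp
    qed (use qQ fR j in \<open>auto simp: I.Icarr\<close>)
    have "q \<in> colon R K (\<phi> ` I)"
      using qQ q fR by (auto simp: colon_iff)
    then have "q \<otimes>\<^bsub>Q\<^esub> \<phi> i \<in> \<phi> ` I"
      using i eq by (simp add: colon_iff)
    then show ?thesis
      using q[OF i] fR[OF i] I.a_subset by simp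
  qed
  moreover have "(\<lambda>i. i) \<in> module_dual R N"
    by (auto simp: module_dual_def N_def I.Icarr)
  ultimately have "{f m | f m. f \<in> module_dual R N \<and> m \<in> carrier N} = I"
    by (fastforce simp: N_def)
  then have "module_trace R N = Idl I"
    by (simp add: module_trace_def)
  also have "\<dots> = I"
    using genideal_self[OF I.a_subset] genideal_minimal[OF I.ideal_axioms] by blast
  finally show "trace_ideal I R"
    using N unfolding trace_ideal_def by blast
qed (rule trace_ideal_colon)

lemma rho_trace_ideal: "I \<in> X_set R \<Longrightarrow> rho R I = colon R K (\<phi> ` I)"
  by (simp add: X_set_def rho_def trace_ideal_colon)


section \<open>The map \<open>\<eta>\<close>\<close>

lemma eta_regular_ideal:
  assumes A: "A \<in> Y_set R"
  shows "eta R A \<in> regular_ideals R"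
proof -
  note AQ = subsetD[OF Y_set_carrier[OF A]]
  have eta_iff: "r \<in> eta R A \<longleftrightarrow> r \<in> carrier R \<and> (\<forall>\<alpha> \<in> A. \<phi> r \<otimes>\<^bsub>Q\<^esub> \<alpha> \<in> K)" for r
    by (auto simp: eta_def colon_iff)
  obtain a where a: "a \<in> W" "\<phi> a <#\<^bsub>Q\<^esub> A \<subseteq> K"
    using A by (auto simp: Y_set_def)
  have a_eta: "a \<in> eta R A"
    using a nonzerodivisors_carrier by (auto simp: eta_iff l_coset_def)
  have l: "s \<otimes> r \<in> eta R A" if r: "r \<in> eta R A" and s: "s \<in> carrier R" for r s
  proof -
    have "\<phi> (s \<otimes> r) \<otimes>\<^bsub>Q\<^esub> \<alpha> \<in> K" if \<alpha>: "\<alpha> \<in> A" for \<alpha>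
    proof -
      obtain t where t: "t \<in> carrier R" "\<phi> r \<otimes>\<^bsub>Q\<^esub> \<alpha> = \<phi> t"
        using r \<alpha> unfolding eta_iff by blast
      have "\<phi> (s \<otimes> r) \<otimes>\<^bsub>Q\<^esub> \<alpha> = \<phi> (s \<otimes> t)"
        using r s t \<alpha> by (simp add: eta_iff Q.m_assoc AQ)
      also have "\<dots> \<in> K" using s t(1) by (intro imageI m_closed)
      finally show ?thesis .
    qed
    then show ?thesis using r s by (simp add: eta_iff del: phi.hom_mult)
  qed
  have "ideal (eta R A) R"
  proof (rule ideal_of_closed)
    show "r \<oplus> s \<in> eta R A" if r: "r \<in> eta R A" and s: "s \<in> eta R A" for r s
    proof -
      have "\<phi> (r \<oplus> s) \<otimes>\<^bsub>Q\<^esub> \<alpha> \<in> K" if \<alpha>: "\<alpha> \<in> A" for \<alpha>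
      proof -
        obtain t where t: "t \<in> carrier R" "\<phi> r \<otimes>\<^bsub>Q\<^esub> \<alpha> = \<phi> t"
          using r \<alpha> unfolding eta_iff by blast
        obtain u where u: "u \<in> carrier R" "\<phi> s \<otimes>\<^bsub>Q\<^esub> \<alpha> = \<phi> u"
          using s \<alpha> unfolding eta_iff by blast
        have "\<phi> (r \<oplus> s) \<otimes>\<^bsub>Q\<^esub> \<alpha> = \<phi> (t \<oplus> u)"
          using r s \<alpha> t u by (simp add: eta_iff Q.l_distr AQ)
        also have "\<dots> \<in> K" using t(1) u(1) by (intro imageI a_closed)
        finally show ?thesis .
      qed
      then show ?thesis using r s by (simp add: eta_iff del: phi.hom_add)
    qed
    show "eta R A \<subseteq> carrier R" by (auto simp: eta_def)
    show "eta R A \<noteq> {}" using a_eta by blast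
  qed (rule l)
  then show ?thesis
    using a(1) a_eta by (auto simp: regular_ideals_def)
qed

text \<open>The conductor \<open>I = R : A\<close> is an ideal of \<open>A\<close>, so \<open>xI \<subseteq> R\<close> gives \<open>(xI)A = xI \<subseteq> R\<close>, that
  is \<open>xI \<subseteq> I\<close>.\<close>

lemma colon_conductor:
  assumes A: "A \<in> Y_set R"
  shows "colon R K (colon R K A) = colon R (colon R K A) (colon R K A)"
proof
  note AQ = subsetD[OF Y_set_carrier[OF A]]
  let ?C = "colon R K A"
  have "?C \<subseteq> K"
    using to_frac_image_eta[OF A] by (auto simp: eta_def)
  then show "colon R ?C ?C \<subseteq> colon R K ?C"
    by (rule colon_mono)
  have CA: "c \<otimes>\<^bsub>Q\<^esub> \<alpha> \<in> ?C" if "c \<in> ?C" "\<alpha> \<in> A" for c \<alpha>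
    using that subringE(6)[OF Y_setD(1)[OF A]] by (auto simp: colon_iff Q.m_assoc AQ)
  show "colon R K ?C \<subseteq> colon R ?C ?C"
  proof
    fix x assume x: "x \<in> colon R K ?C"
    then have xQ: "x \<in> carrier Q" by (simp add: colon_iff)
    have "x \<otimes>\<^bsub>Q\<^esub> c \<in> ?C" if c: "c \<in> ?C" for c
    proof -
      have cQ: "c \<in> carrier Q" using c by (simp add: colon_iff)
      have "x \<otimes>\<^bsub>Q\<^esub> c \<otimes>\<^bsub>Q\<^esub> \<alpha> \<in> K" if "\<alpha> \<in> A" for \<alpha>
      proof -
        have "x \<otimes>\<^bsub>Q\<^esub> (c \<otimes>\<^bsub>Q\<^esub> \<alpha>) \<in> K"
          using x CA[OF c that] unfolding colon_iff[of x] by blast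
        then show ?thesis using xQ cQ AQ[OF that] by (simp add: Q.m_assoc)
      qed
      then show ?thesis using xQ cQ by (simp add: colon_iff)
    qed
    then show "x \<in> colon R ?C ?C"
      using xQ unfolding colon_iff[of x] by blast
  qed
qed

lemma eta_in_X_set:
  assumes A: "A \<in> Y_set R"
  shows "eta R A \<in> X_set R"
  using regular_trace_ideal_iff[OF eta_regular_ideal[OF A]] eta_regular_ideal[OF A]
    colon_conductor[OF A]
  by (simp add: X_set_def to_frac_image_eta[OF A])

lemma rho_eta: "A \<in> Y_set R \<Longrightarrow> rho R (eta R A) = colon R K (colon R K A)"
  by (simp add: rho_trace_ideal[OF eta_in_X_set] to_frac_image_eta)

lemma rho_in_Y_set: "I \<in> X_set R \<Longrightarrow> rho R I \<in> Y_set R"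
  unfolding rho_def by (rule self_colon_in_Y_set) (simp add: X_set_def)

lemma eta_eq_iff:
  assumes "A \<in> Y_set R" "B \<in> Y_set R"
  shows "eta R A = eta R B \<longleftrightarrow> colon R K A = colon R K B"
proof
  show "eta R A = eta R B" if "colon R K A = colon R K B"
    using that by (simp add: eta_def)
qed (simp flip: to_frac_image_eta[OF assms(1)] to_frac_image_eta[OF assms(2)])


section \<open>The equivalences\<close>

lemma rho_surj_iff_reflexive:
  "rho R ` X_set R = Y_set R \<longleftrightarrow> (\<forall>A \<in> Y_set R. A = colon R K (colon R K A))"
proof
  assume surj: "rho R ` X_set R = Y_set R"
  show "\<forall>A \<in> Y_set R. A = colon R K (colon R K A)"
  proof
    fix A assume "A \<in> Y_set R"
    then obtain I where I: "I \<in> X_set R" "A = rho R I" using surj by blast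
    then have "\<phi> ` I \<subseteq> carrier Q"
      by (auto simp: X_set_def dest!: regular_idealD dest: ideal.Icarr)
    then show "A = colon R K (colon R K A)"
      using I by (simp add: rho_trace_ideal colon_colon_colon)
  qed
next
  assume refl: "\<forall>A \<in> Y_set R. A = colon R K (colon R K A)"
  show "rho R ` X_set R = Y_set R"
  proof
    show "rho R ` X_set R \<subseteq> Y_set R" using rho_in_Y_set by blast
    show "Y_set R \<subseteq> rho R ` X_set R"
      using refl eta_in_X_set rho_eta by (metis image_eqI subsetI)
  qed
qed

text \<open>If \<open>\<eta>\<close> is injective then \<open>A\<close> and \<open>\<rho>(\<eta>(A)) = R : (R : A)\<close> coincide, because both lie in
  \<open>Y_set R\<close> and have the same conductor.\<close>

lemma eta_inj_iff_reflexive: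
  "inj_on (eta R) (Y_set R) \<longleftrightarrow> (\<forall>A \<in> Y_set R. A = colon R K (colon R K A))"
proof
  assume inj: "inj_on (eta R) (Y_set R)"
  show "\<forall>A \<in> Y_set R. A = colon R K (colon R K A)"
  proof
    fix A assume A: "A \<in> Y_set R"
    let ?B = "colon R K (colon R K A)"
    have B: "?B \<in> Y_set R"
      using rho_in_Y_set[OF eta_in_X_set[OF A]] by (simp add: rho_eta[OF A])
    have "eta R A = eta R ?B"
      using eta_eq_iff[OF A B] colon_colon_colon[OF Y_set_carrier[OF A]] by simp
    then show "A = ?B" by (rule inj_onD[OF inj _ A B])
  qed
next
  assume "\<forall>A \<in> Y_set R. A = colon R K (colon R K A)"
  then show "inj_on (eta R) (Y_set R)"
    by (metis inj_onI eta_eq_iff)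
qed

lemma xi_image: "xi R ` Z_set R = Y_set R"
proof
  show "xi R ` Z_set R \<subseteq> Y_set R"
    by (auto simp: xi_def Z_set_def intro: self_colon_in_Y_set)
  show "Y_set R \<subseteq> xi R ` Z_set R"
    by (auto elim: xi_surj)
qed

end

theorem proposition1p2:
  fixes R :: "('a, 'b) ring_scheme"
  assumes "cring R"
  shows "xi R ` Z_set R = Y_set R \<and>
    (rho R ` X_set R = Y_set R \<longleftrightarrow> inj_on (eta R) (Y_set R)) \<and>
    (inj_on (eta R) (Y_set R) \<longleftrightarrow>
      (\<forall>A \<in> Y_set R.
        A = colon R (to_frac R ` carrier R) (colon R (to_frac R ` carrier R) A)))"
proof -
  interpret total_fractions R
    by (intro total_fractions.intro assms)
  show ?thesis
    using xi_image rho_surj_iff_reflexive eta_inj_iff_reflexive by blast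
qed

end
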